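(* For any positive integer $d$, let $\mathcal{SD}_d$ be the class of all signed graphs $(G,\sigma)$ whose underlying graph $G$ is a (finite) simple $d$-degenerate graph. Then $$\sup\{\chi_c(G,\sigma):(G,\sigma)\in\mathcal{SD}_d\}=2\left\lfloor \tfrac{d}{2}\right\rfloor+2.$$
   Context: A signed graph $(G,\sigma)$ is a graph $G$ with a signature $\sigma:E(G)\to\{+,-\}$. For real $r\ge 1$, $C^r$ is the circle of circumference $r$ (points are $[0,r)$), $d_{(\mathrm{mod}\, r)}(x,y)$ is the length of the shorter arc of $C^r$ between $x$ and $y$, and the antipodal $\bar x$ of $x$ is the point at distance $r/2$ from $x$. A circular $r$-coloring of $(G,\sigma)$ is a map $f:V(G)\to C^r$ such that $d_{(\mathrm{mod}\, r)}(f(u),f(v))\ge 1$ for each positive edge $uv$ and $d_{(\mathrm{mod}\, r)}(f(u),\overline{f(v)})\ge 1$ for each negative edge $uv$. $\chi_c(G,\sigma)=\inf\{r\ge 1: (G,\sigma)\text{ admits a circular } r\text{-coloring}\}$. A graph is $d$-degenerate if every nonempty subgraph has a vertex of degree at most $d$. *)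

theory Defs
  imports "HOL-Library.Extended_Real" "HOL-Library.Infinite_Typeclass"
begin

section \<open>Signed graphs\<close>

text \<open>
  A graph is a vertex set \<open>V\<close> with a set \<open>E\<close> of two-element subsets of \<open>V\<close>.
  Signatures are total functions; their values outside \<open>E\<close> are never used.
\<close>

definition simple_graph :: "'a set \<Rightarrow> 'a set set \<Rightarrow> bool" where
  "simple_graph V E \<longleftrightarrow> finite V \<and> (\<forall>e\<in>E. e \<subseteq> V \<and> card e = 2)"

definition subgraph :: "'a set \<Rightarrow> 'a set set \<Rightarrow> 'a set \<Rightarrow> 'a set set \<Rightarrow> bool" where
  "subgraph W F V E \<longleftrightarrow> W \<subseteq> V \<and> F \<subseteq> E \<and> (\<forall>e\<in>F. e \<subseteq> W)"

definition degree :: "'a set set \<Rightarrow> 'a \<Rightarrow> nat" where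
  "degree E v = card {e \<in> E. v \<in> e}"

definition degenerate :: "nat \<Rightarrow> 'a set \<Rightarrow> 'a set set \<Rightarrow> bool" where
  "degenerate d V E \<longleftrightarrow>
     (\<forall>W F. subgraph W F V E \<and> W \<noteq> {} \<longrightarrow> (\<exists>v\<in>W. degree F v \<le> d))"

datatype sign = Positive | Negative

definition signed_degenerate ::
  "nat \<Rightarrow> ('a set \<times> 'a set set \<times> ('a set \<Rightarrow> sign)) set" where
  "signed_degenerate d = {(V, E, \<sigma>). simple_graph V E \<and> degenerate d V E}"

section \<open>Circular colorings\<close>

definition circle :: "real \<Rightarrow> real set" where
  "circle r = {0..<r}"

definition circ_dist :: "real \<Rightarrow> real \<Rightarrow> real \<Rightarrow> real" where
  "circ_dist r x y = min \<bar>x - y\<bar> (r - \<bar>x - y\<bar>)"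

definition antipode :: "real \<Rightarrow> real \<Rightarrow> real" where
  "antipode r x = (THE y. y \<in> circle r \<and> circ_dist r x y = r / 2)"

lemma antipode_eq:
  assumes "x \<in> circle r"
  shows "antipode r x = (if x < r / 2 then x + r / 2 else x - r / 2)"
  unfolding antipode_def
proof (rule the_equality)
  show "(if x < r / 2 then x + r / 2 else x - r / 2) \<in> circle r \<and>
      circ_dist r x (if x < r / 2 then x + r / 2 else x - r / 2) = r / 2"
    using assms by (auto simp: circle_def circ_dist_def)
next
  fix y assume "y \<in> circle r \<and> circ_dist r x y = r / 2"
  then show "y = (if x < r / 2 then x + r / 2 else x - r / 2)"
    using assms by (auto simp: circle_def circ_dist_def min_def abs_if split: if_splits)
qed

definition circular_coloring ::
  "real \<Rightarrow> 'a set \<Rightarrow> 'a set set \<Rightarrow> ('a set \<Rightarrow> sign) \<Rightarrow> ('a \<Rightarrow> real) \<Rightarrow> bool" where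
  "circular_coloring r V E \<sigma> f \<longleftrightarrow>
     (\<forall>v\<in>V. f v \<in> circle r) \<and>
     (\<forall>u v. {u, v} \<in> E \<and> \<sigma> {u, v} = Positive \<longrightarrow> circ_dist r (f u) (f v) \<ge> 1) \<and>
     (\<forall>u v. {u, v} \<in> E \<and> \<sigma> {u, v} = Negative \<longrightarrow> circ_dist r (f u) (antipode r (f v)) \<ge> 1)"

text \<open>
  The infimum is taken in the extended reals, so that it and suprema of such values
  have their usual meaning without side conditions on nonemptiness and boundedness.
\<close>

definition circular_chromatic_number ::
  "'a set \<Rightarrow> 'a set set \<Rightarrow> ('a set \<Rightarrow> sign) \<Rightarrow> ereal" where
  "circular_chromatic_number V E \<sigma> =
     (INF r \<in> {r. r \<ge> 1 \<and> (\<exists>f. circular_coloring r V E \<sigma> f)}. ereal r)"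

end

theory Submission
  imports Defs
begin

text \<open>
  Write \<open>n = 2 * (d div 2) + 2\<close>, the least even integer exceeding \<open>d\<close>.

  Upper bound: on the circle of circumference \<open>n\<close> use only the \<open>n\<close> integer points. Since \<open>n\<close> is
  even, antipodes of integer points are integer points, so an already colored neighbor excludes
  just one of them and the greedy coloring of a \<open>d\<close>-degenerate graph succeeds.

  Lower bound: if \<open>r < n\<close>, then among sufficiently many vertices two, \<open>a\<close> and \<open>b\<close>, get almost the
  same color. A vertex joined to \<open>a\<close> positively and to \<open>b\<close> negatively is then far from the color of
  \<open>a\<close> and almost as far from its antipode. Repeatedly attach many new vertices to every possible
  choice of \<open>j\<close> such pairs, for \<open>j = 0, \<dots>, d div 2\<close>; a new vertex has degree at most \<open>2 * j \<le> d\<close>.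
  Every coloring then has \<open>d div 2 + 1\<close> vertices whose colors are, modulo \<open>r / 2\<close>, pairwise at
  distance almost \<open>1\<close>, so \<open>r / 2\<close> is at least almost \<open>d div 2 + 1\<close>.
  For \<open>d = 1\<close> this says nothing, as there is only one such vertex; there a single edge suffices.
\<close>

section \<open>Greedy colorings\<close>

lemma degenerate_subgraph:
  assumes "degenerate d V E" "subgraph W F V E"
  shows "degenerate d W F"
  using assms unfolding degenerate_def subgraph_def by (meson order_trans)

lemma simple_graph_finite_edges:
  assumes "simple_graph V E"
  shows "finite E"
  using assms unfolding simple_graph_def by (meson PowI finite_Pow_iff finite_subset subsetI)

text \<open>Remove a vertex of degree at most \<open>d\<close>, color the rest by induction, and
  note that each edge at the removed vertex forbids one color. The map \<open>\<pi> e\<close>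
  abstracts the sign of \<open>e\<close>; that it is its own inverse on \<open>C\<close> makes the
  constraint independent of the order of the ends of \<open>e\<close>.\<close>

lemma degenerate_greedy_coloring:
  fixes \<pi> :: "'a set \<Rightarrow> 'c \<Rightarrow> 'c"
  assumes "simple_graph V E" "degenerate d V E"
    and "finite C" "d < card C"
    and involution: "\<And>e x. x \<in> C \<Longrightarrow> \<pi> e (\<pi> e x) = x"
  shows "\<exists>c. (\<forall>v\<in>V. c v \<in> C) \<and> (\<forall>u v. {u, v} \<in> E \<longrightarrow> c u \<noteq> \<pi> {u, v} (c v))"
proof -
  have "finite V" using assms by (simp add: simple_graph_def)
  then show ?thesis using assms(1,2)
  proof (induction V arbitrary: E rule: finite_psubset_induct)
    case (psubset V)
    show ?case
    proof (cases "V = {}")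
      case True
      then have "E = {}" using psubset.prems by (auto simp: simple_graph_def)
      then show ?thesis using True by auto
    next
      case False
      have "subgraph V E V E"
        using psubset.prems by (auto simp: subgraph_def simple_graph_def)
      then obtain v where v: "v \<in> V" "degree E v \<le> d"
        using psubset.prems False by (auto simp: degenerate_def)
      define E' where "E' = {e \<in> E. v \<notin> e}"
      have "simple_graph (V - {v}) E'"
        using psubset.prems by (auto simp: simple_graph_def E'_def)
      moreover have "subgraph (V - {v}) E' V E"
        using psubset.prems by (auto simp: subgraph_def simple_graph_def E'_def)
      ultimately obtain c where c: "\<forall>u\<in>V - {v}. c u \<in> C"
          "\<And>u w. {u, w} \<in> E' \<Longrightarrow> c u \<noteq> \<pi> {u, w} (c w)"
        using psubset.IH[of "V - {v}" E'] v degenerate_subgraph[OF psubset.prems(2)] by blast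
      \<comment> \<open>Degrees count edges, while forbidden colors are indexed by neighbors; the
        injection \<open>u\<close> to \<open>{v, u}\<close> passes between the two.\<close>
      define N where "N = {u. {v, u} \<in> E}"
      have fin: "finite {e \<in> E. v \<in> e}"
        using simple_graph_finite_edges[OF psubset.prems(1)] by simp
      have inj: "inj_on (\<lambda>u. {v, u}) N" by (auto simp: inj_on_def doubleton_eq_iff)
      have sub: "(\<lambda>u. {v, u}) ` N \<subseteq> {e \<in> E. v \<in> e}" by (auto simp: N_def)
      have "card N \<le> d"
        using card_inj_on_le[OF inj sub fin] v(2) by (simp add: degree_def)
      moreover have "finite N" using inj_on_finite[OF inj sub fin] .
      ultimately have "card ((\<lambda>u. \<pi> {v, u} (c u)) ` N) < card C"
        using card_image_le[of N "\<lambda>u. \<pi> {v, u} (c u)"] \<open>d < card C\<close> by linarith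
      then obtain x where x: "x \<in> C" "x \<notin> (\<lambda>u. \<pi> {v, u} (c u)) ` N"
        using \<open>finite N\<close> card_mono[of "(\<lambda>u. \<pi> {v, u} (c u)) ` N" C] by fastforce
      have "(c(v := x)) u \<noteq> \<pi> {u, w} ((c(v := x)) w)" if e: "{u, w} \<in> E" for u w
      proof -
        have uw: "u \<noteq> w" "u \<in> V" "w \<in> V"
          using e psubset.prems(1) by (auto simp: simple_graph_def)
        consider "u = v" | "w = v" | "u \<noteq> v" "w \<noteq> v" by auto
        then show ?thesis
        proof cases
          case 1
          then show ?thesis using x e uw by (auto simp: N_def)
        next
          case 2
          \<comment> \<open>\<open>x\<close> was chosen for edges read from \<open>v\<close>; for
            the opposite reading, apply \<open>\<pi> {u, w}\<close> to both sides.\<close>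
          then have "x \<noteq> \<pi> {u, w} (c u)" using x e by (auto simp: N_def insert_commute)
          moreover have "c u \<in> C" using c uw 2 by auto
          ultimately show ?thesis
            using involution[of "x" "{u, w}"] x(1) 2 uw by auto
        next
          case 3
          then show ?thesis using c(2)[of u w] e by (auto simp: E'_def)
        qed
      qed
      then show ?thesis using c x by (intro exI[of _ "c(v := x)"]) auto
    qed
  qed
qed

text \<open>Greedy coloring with the integer points as colors, where \<open>\<pi> e\<close> is the
  identity or the antipodal map according to the sign of \<open>e\<close>.\<close>

lemma degenerate_circular_coloring:
  assumes "simple_graph V E" "degenerate d V E" "even n" "d < n"
  shows "\<exists>f. circular_coloring (real n) V E \<sigma> f"
proof -
  define C where "C = real ` {..<n}"
  define \<pi> where "\<pi> e x = (if \<sigma> e = Positive then x else antipode (real n) x)" for e x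
  obtain m where m: "n = 2 * m" using \<open>even n\<close> by blast
  have C_circle: "C \<subseteq> circle (real n)" by (auto simp: C_def circle_def)
  have antipode_C: "antipode (real n) x \<in> C" if "x \<in> C" for x
  proof -
    obtain i where i: "x = real i" "i < n" using \<open>x \<in> C\<close> by (auto simp: C_def)
    have "antipode (real n) x = real (if i < m then i + m else i - m)"
      using that C_circle i m by (subst antipode_eq) auto
    moreover have "(if i < m then i + m else i - m) < n" using i m by auto
    ultimately show ?thesis unfolding C_def by blast
  qed
  \<comment> \<open>Both arcs between distinct integer points have positive integer length, because
    the circumference is an integer.\<close>
  have dist: "circ_dist (real n) x y \<ge> 1" if "x \<in> C" "y \<in> C" "x \<noteq> y" for x y
  proof -
    obtain i j where ij: "x = real i" "y = real j" "i < n" "j < n"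
      using \<open>x \<in> C\<close> \<open>y \<in> C\<close> by (auto simp: C_def)
    with \<open>x \<noteq> y\<close> consider "i + 1 \<le> j" "j + 1 \<le> n + i" | "j + 1 \<le> i" "i + 1 \<le> n + j" by force
    then show ?thesis using ij by cases (auto simp: circ_dist_def)
  qed
  have "\<pi> e (\<pi> e x) = x" if "x \<in> C" for e x
    using that C_circle antipode_C[OF that] antipode_eq[of x "real n"]
      antipode_eq[of "antipode (real n) x" "real n"]
    by (auto simp: \<pi>_def circle_def subset_eq)
  moreover have "finite C" "card C = n" by (simp_all add: C_def card_image)
  ultimately obtain c where c: "\<forall>v\<in>V. c v \<in> C"
      "\<And>u v. {u, v} \<in> E \<Longrightarrow> c u \<noteq> \<pi> {u, v} (c v)"
    using degenerate_greedy_coloring[OF assms(1,2), of C \<pi>] \<open>d < n\<close> by blast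
  have ends: "c u \<in> C" "c v \<in> C" if "{u, v} \<in> E" for u v
    using that assms(1) c(1) by (auto simp: simple_graph_def)
  have "circular_coloring (real n) V E \<sigma> c"
    unfolding circular_coloring_def
  proof (intro conjI ballI allI impI; (elim conjE)?)
    fix v assume "v \<in> V"
    then show "c v \<in> circle (real n)" using c(1) C_circle by auto
  next
    fix u v assume e: "{u, v} \<in> E" and "\<sigma> {u, v} = Positive"
    then have "c u \<noteq> c v" using c(2)[OF e] by (simp add: \<pi>_def)
    then show "1 \<le> circ_dist (real n) (c u) (c v)" by (rule dist[OF ends[OF e]])
  next
    fix u v assume e: "{u, v} \<in> E" and "\<sigma> {u, v} = Negative"
    then have "c u \<noteq> antipode (real n) (c v)" using c(2)[OF e] by (simp add: \<pi>_def)
    then show "1 \<le> circ_dist (real n) (c u) (antipode (real n) (c v))"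
      by (rule dist[OF ends(1)[OF e] antipode_C[OF ends(2)[OF e]]])
  qed
  then show ?thesis by blast
qed

section \<open>Separated points\<close>

text \<open>Adding points in increasing order, each new maximum lies at least \<open>c\<close>
  beyond the right end supplied by the induction hypothesis.\<close>

lemma separated_spread:
  fixes T :: "real set"
  assumes "finite T" "T \<noteq> {}"
    and "\<And>x y. x \<in> T \<Longrightarrow> y \<in> T \<Longrightarrow> x \<noteq> y \<Longrightarrow> c \<le> \<bar>x - y\<bar>"
  shows "\<exists>x\<in>T. \<exists>y\<in>T. (real (card T) - 1) * c \<le> y - x"
  using assms
proof (induction T rule: finite_linorder_max_induct)
  case empty
  then show ?case by simp
next
  case (insert b A)
  show ?case
  proof (cases "A = {}")
    case True
    then show ?thesis by simp
  next
    case False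
    then obtain x y where xy: "x \<in> A" "y \<in> A" "(real (card A) - 1) * c \<le> y - x"
      using insert.IH insert.prems by (metis insertCI)
    have "y < b" "b \<notin> A" using insert.hyps xy by auto
    moreover have "c \<le> \<bar>b - y\<bar>" using insert.prems(2)[of b y] xy \<open>y < b\<close> by auto
    ultimately have "(real (card (insert b A)) - 1) * c \<le> b - x"
      using xy insert.hyps(1) by (simp add: abs_if algebra_simps)
    then show ?thesis using xy by blast
  qed
qed

text \<open>Pigeonhole: otherwise the values would spread over a length of at least
  \<open>r\<close>, which the half-open interval does not allow.\<close>

lemma close_pair:
  fixes f :: "'a \<Rightarrow> real"
  assumes "finite Z" "Z \<noteq> {}" "\<And>z. z \<in> Z \<Longrightarrow> f z \<in> {0..<r}" "\<delta> > 0"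
    and "r \<le> (real (card Z) - 1) * \<delta>"
  shows "\<exists>x\<in>Z. \<exists>y\<in>Z. x \<noteq> y \<and> \<bar>f x - f y\<bar> < \<delta>"
proof (rule ccontr)
  assume "\<not> ?thesis"
  then have sep: "\<delta> \<le> \<bar>f x - f y\<bar>" if "x \<in> Z" "y \<in> Z" "x \<noteq> y" for x y
    using that by force
  then have "inj_on f Z" using \<open>\<delta> > 0\<close> by (fastforce simp: inj_on_def)
  then have "card (f ` Z) = card Z" by (rule card_image)
  moreover have "\<exists>x\<in>f ` Z. \<exists>y\<in>f ` Z. (real (card (f ` Z)) - 1) * \<delta> \<le> y - x"
    by (rule separated_spread) (use assms sep in auto)
  ultimately obtain x y where "x \<in> Z" "y \<in> Z" "(real (card Z) - 1) * \<delta> \<le> f y - f x"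
    by auto
  then show False using assms(3)[of x] assms(3)[of y] assms(5) by simp
qed

section \<open>The circle modulo antipodes\<close>

definition half_circle :: "real \<Rightarrow> real \<Rightarrow> real" where
  "half_circle r x = (if x < r / 2 then x else x - r / 2)"

text \<open>Identifying antipodes yields a circle of circumference \<open>r / 2\<close>, on which
  \<open>half_circle\<close> picks representatives. The two inequalities bound both arcs of that
  circle from below by \<open>c\<close>.\<close>

definition antipodally_separated :: "real \<Rightarrow> real \<Rightarrow> real \<Rightarrow> real \<Rightarrow> bool" where
  "antipodally_separated r c x y \<longleftrightarrow>
     c \<le> \<bar>half_circle r x - half_circle r y\<bar> \<and> \<bar>half_circle r x - half_circle r y\<bar> \<le> r / 2 - c"

lemma antipodally_separated_commute:
  "antipodally_separated r c x y \<longleftrightarrow> antipodally_separated r c y x"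
  by (simp add: antipodally_separated_def abs_minus_commute)

text \<open>The antipodes of \<open>x\<close> and \<open>y\<close> are as close as \<open>x\<close>
  and \<open>y\<close>, so \<open>z\<close> stays more than \<open>1 - (1 - c) = c\<close> away from
  the antipode of \<open>x\<close>.\<close>

lemma antipodally_separatedI:
  assumes "x \<in> circle r" "y \<in> circle r" "z \<in> circle r"
    and "circ_dist r z x \<ge> 1" "circ_dist r z (antipode r y) \<ge> 1"
    and "\<bar>x - y\<bar> < 1 - c" "0 < c" "c < 1"
  shows "antipodally_separated r c z x"
  using assms antipode_eq[OF assms(2)]
  unfolding antipodally_separated_def half_circle_def circle_def circ_dist_def
  by (auto simp: min_def abs_if split: if_splits)

text \<open>Going once around the circle of circumference \<open>r / 2\<close> crosses
  \<open>card A\<close> gaps of length at least \<open>c\<close>: all but one come from the spread,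
  the last is the arc closing the circle.\<close>

lemma antipodally_separated_card:
  assumes "finite A" "2 \<le> card A" "\<And>a. a \<in> A \<Longrightarrow> f a \<in> circle r" "0 < c"
    and sep: "\<And>a b. a \<in> A \<Longrightarrow> b \<in> A \<Longrightarrow> a \<noteq> b \<Longrightarrow> antipodally_separated r c (f a) (f b)"
  shows "real (card A) * c \<le> r / 2"
proof -
  let ?h = "\<lambda>a. half_circle r (f a)"
  have inj: "inj_on ?h A"
    using sep \<open>0 < c\<close> by (fastforce simp: inj_on_def antipodally_separated_def)
  have card: "card (?h ` A) = card A" using inj by (rule card_image)
  have "\<exists>x\<in>?h ` A. \<exists>y\<in>?h ` A. (real (card (?h ` A)) - 1) * c \<le> y - x"
    by (rule separated_spread) (use assms in \<open>auto simp: antipodally_separated_def\<close>)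
  then obtain a b where ab: "a \<in> A" "b \<in> A" "(real (card A) - 1) * c \<le> ?h b - ?h a"
    using card by auto
  have "0 < (real (card A) - 1) * c" using assms by simp
  then have "a \<noteq> b" using ab by auto
  then have "?h b - ?h a \<le> r / 2 - c"
    using sep[OF ab(1,2)] by (auto simp: antipodally_separated_def abs_if split: if_splits)
  then show ?thesis using ab by (simp add: algebra_simps)
qed

section \<open>Attaching vertices\<close>

text \<open>New vertices are joined only to old ones, so a subgraph containing a new vertex has a
  vertex of degree at most \<open>d\<close>, and any other is a subgraph of the old graph.\<close>

lemma signed_degenerate_attach:
  assumes G: "(V, E, \<sigma>) \<in> signed_degenerate d"
    and Z: "finite Z" "Z \<inter> V = {}"
    and PM: "\<And>z. z \<in> Z \<Longrightarrow> P z \<subseteq> V \<and> M z \<subseteq> V \<and> P z \<inter> M z = {} \<and> card (P z \<union> M z) \<le> d"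
  shows "\<exists>E' \<sigma>'. (V \<union> Z, E', \<sigma>') \<in> signed_degenerate d \<and>
    (\<forall>r f. circular_coloring r (V \<union> Z) E' \<sigma>' f \<longrightarrow> circular_coloring r V E \<sigma> f) \<and>
    (\<forall>z\<in>Z. \<forall>a\<in>P z. {z, a} \<in> E' \<and> \<sigma>' {z, a} = Positive) \<and>
    (\<forall>z\<in>Z. \<forall>a\<in>M z. {z, a} \<in> E' \<and> \<sigma>' {z, a} = Negative)"
proof -
  define E' where "E' = E \<union> {{z, a} | z a. z \<in> Z \<and> a \<in> P z \<union> M z}"
  define \<sigma>' where "\<sigma>' e = (if e \<in> E then \<sigma> e
    else if \<exists>z\<in>Z. \<exists>a\<in>P z. e = {z, a} then Positive else Negative)" for e
  have simple: "simple_graph V E" and degen: "degenerate d V E"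
    using G by (auto simp: signed_degenerate_def)
  then have E: "e \<subseteq> V" "card e = 2" if "e \<in> E" for e
    using that by (auto simp: simple_graph_def)
  have finV: "finite V" using simple by (simp add: simple_graph_def)
  have new: "{z, a} \<notin> E" if "z \<in> Z" for z a using E(1)[of "{z, a}"] that Z by auto
  have "card {z, a} = 2" if "z \<in> Z" "a \<in> P z \<union> M z" for z a
    using PM[of z] Z that by (subst card_2_iff) blast
  then have "simple_graph (V \<union> Z) E'"
    using E PM finV Z unfolding simple_graph_def E'_def by blast
  moreover have "degenerate d (V \<union> Z) E'"
    unfolding degenerate_def
  proof (intro allI impI)
    fix W F assume WF: "subgraph W F (V \<union> Z) E' \<and> W \<noteq> {}"
    show "\<exists>v\<in>W. degree F v \<le> d"
    proof (cases "W \<inter> Z = {}")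
      case True
      then have "F \<subseteq> E" using WF unfolding subgraph_def E'_def by blast
      then have "subgraph W F V E" using WF True by (auto simp: subgraph_def)
      then show ?thesis using degen WF by (simp add: degenerate_def)
    next
      case False
      then obtain z where z: "z \<in> W" "z \<in> Z" by blast
      have "{e \<in> F. z \<in> e} \<subseteq> (\<lambda>a. {z, a}) ` (P z \<union> M z)"
      proof
        fix e assume "e \<in> {e \<in> F. z \<in> e}"
        then have e: "e \<in> E'" "z \<in> e" using WF by (auto simp: subgraph_def)
        then have "e \<notin> E" using E z Z by blast
        then obtain y a where ya: "e = {y, a}" "y \<in> Z" "a \<in> P y \<union> M y"
          using e by (auto simp: E'_def)
        then have "a \<in> V" using PM by blast
        then have "y = z" using e ya z Z by auto
        then show "e \<in> (\<lambda>a. {z, a}) ` (P z \<union> M z)" using ya by blast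
      qed
      moreover have fin: "finite (P z \<union> M z)"
        using PM[OF z(2)] finV by (meson Un_least finite_subset)
      ultimately have "degree F z \<le> card ((\<lambda>a. {z, a}) ` (P z \<union> M z))"
        unfolding degree_def by (intro card_mono) auto
      also have "\<dots> \<le> d" using card_image_le[OF fin] PM[OF z(2)] order_trans by blast
      finally show ?thesis using z by blast
    qed
  qed
  ultimately have "(V \<union> Z, E', \<sigma>') \<in> signed_degenerate d"
    by (simp add: signed_degenerate_def)
  moreover have "circular_coloring r V E \<sigma> f" if "circular_coloring r (V \<union> Z) E' \<sigma>' f" for r f
    using that by (auto simp: circular_coloring_def E'_def \<sigma>'_def)
  moreover have "{z, a} \<in> E' \<and> \<sigma>' {z, a} = Positive" if "z \<in> Z" "a \<in> P z" for z a
    using that new by (auto simp: E'_def \<sigma>'_def)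
  moreover have "{z, a} \<in> E' \<and> \<sigma>' {z, a} = Negative" if z: "z \<in> Z" "a \<in> M z" for z a
  proof -
    \<comment> \<open>A new edge has exactly one end in \<open>Z\<close>, so it determines
      \<open>z\<close> and \<open>a\<close>; disjointness of \<open>P z\<close> and
      \<open>M z\<close> then fixes its sign.\<close>
    have "\<not> (\<exists>y\<in>Z. \<exists>b\<in>P y. {z, a} = {y, b})"
    proof
      assume "\<exists>y\<in>Z. \<exists>b\<in>P y. {z, a} = {y, b}"
      then obtain y b where yb: "y \<in> Z" "b \<in> P y" "{z, a} = {y, b}" by blast
      then have "b \<in> V" "a \<in> V" using PM z by blast+
      then have "z = y" "a = b" using yb z Z by (auto simp: doubleton_eq_iff)
      then show False using yb z PM by blast
    qed
    then show ?thesis using z new by (auto simp: E'_def \<sigma>'_def)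
  qed
  ultimately show ?thesis by blast
qed

text \<open>One graph must serve all colorings with \<open>r \<le> s\<close>, while \<open>A\<close>
  and \<open>B\<close> may depend on the coloring. \<open>B\<close> provides the close partners to
  which the next round attaches negative edges.\<close>

lemma signed_degenerate_forces_separation:
  fixes c s :: real
  assumes c: "0 < c" "c < 1" and "j \<le> d div 2 + 1"
  shows "\<exists>V E \<sigma>. (V, E, \<sigma>) \<in> (signed_degenerate d ::
      ('a::infinite set \<times> 'a set set \<times> ('a set \<Rightarrow> sign)) set) \<and>
    (\<forall>r f. r \<le> s \<and> circular_coloring r V E \<sigma> f \<longrightarrow>
      (\<exists>A B. A \<subseteq> V \<and> B \<subseteq> V \<and> A \<inter> B = {} \<and> card A = j \<and> card B = j \<and>
        (\<forall>a\<in>A. \<exists>b\<in>B. \<bar>f a - f b\<bar> < 1 - c) \<and>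
        (\<forall>a\<in>A. \<forall>b\<in>A. a \<noteq> b \<longrightarrow> antipodally_separated r c (f a) (f b))))"
  using assms(3)
proof (induction j)
  case 0
  have "({}, {}, \<lambda>_. Positive) \<in> signed_degenerate d"
    by (auto simp: signed_degenerate_def simple_graph_def degenerate_def subgraph_def)
  then show ?case by (intro exI[of _ "{}"] exI[of _ "\<lambda>_. Positive"]) auto
next
  case (Suc j)
  obtain V :: "'a set" and E \<sigma> where G: "(V, E, \<sigma>) \<in> signed_degenerate d"
    and forces: "\<And>r f. r \<le> s \<Longrightarrow> circular_coloring r V E \<sigma> f \<Longrightarrow>
      \<exists>A B. A \<subseteq> V \<and> B \<subseteq> V \<and> A \<inter> B = {} \<and> card A = j \<and> card B = j \<and>
        (\<forall>a\<in>A. \<exists>b\<in>B. \<bar>f a - f b\<bar> < 1 - c) \<and>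
        (\<forall>a\<in>A. \<forall>b\<in>A. a \<noteq> b \<longrightarrow> antipodally_separated r c (f a) (f b))"
    using Suc by auto
  have finV: "finite V" using G by (simp add: signed_degenerate_def simple_graph_def)
  \<comment> \<open>All pairs that some coloring might produce; each receives its own supply of new
    vertices.\<close>
  define Q where
    "Q = {(A, B). A \<subseteq> V \<and> B \<subseteq> V \<and> A \<inter> B = {} \<and> card A = j \<and> card B = j}"
  have "Q \<subseteq> Pow V \<times> Pow V" by (auto simp: Q_def)
  then have finQ: "finite Q" using finV finite_subset by blast
  \<comment> \<open>With \<open>n + 1\<close> new vertices per pair, \<open>close_pair\<close>
    applies with gap \<open>1 - c\<close>, since \<open>n * (1 - c)\<close> is at least
    \<open>s\<close> and hence at least \<open>r\<close>.\<close>
  obtain n :: nat where "s / (1 - c) \<le> real n" using real_arch_simple by blast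
  then have n: "s \<le> real n * (1 - c)" using c by (simp add: field_simps)
  have "infinite (- V)" using finV by (simp add: Compl_eq_Diff_UNIV infinite_UNIV)
  then obtain Z where Z: "Z \<subseteq> - V" "finite Z" "card Z = card (Q \<times> {..n})"
    using infinite_arbitrarily_large by metis
  \<comment> \<open>\<open>p\<close> labels each new vertex by the pair it is attached to and an
    index in \<open>{..n}\<close>.\<close>
  then obtain p where p: "bij_betw p Z (Q \<times> {..n})"
    using finQ finite_same_card_bij[of Z "Q \<times> {..n}"] by auto
  define P where "P z = fst (fst (p z))" for z
  define M where "M z = snd (fst (p z))" for z
  have PM: "P z \<subseteq> V \<and> M z \<subseteq> V \<and> P z \<inter> M z = {} \<and> card (P z \<union> M z) \<le> d" if "z \<in> Z" for z
  proof -
    have "fst (p z) \<in> Q" using bspec[OF bij_betwE[OF p] that] by (simp add: mem_Times_iff)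
    then have "P z \<subseteq> V" "M z \<subseteq> V" "P z \<inter> M z = {}" "card (P z) = j" "card (M z) = j"
      by (auto simp: Q_def P_def M_def)
    moreover have "card (P z \<union> M z) \<le> card (P z) + card (M z)" by (rule card_Un_le)
    ultimately show ?thesis using Suc.prems by auto
  qed
  have "Z \<inter> V = {}" using Z(1) by blast
  obtain E' \<sigma>' where G': "(V \<union> Z, E', \<sigma>') \<in> signed_degenerate d"
    and restrict: "\<And>r f. circular_coloring r (V \<union> Z) E' \<sigma>' f \<Longrightarrow> circular_coloring r V E \<sigma> f"
    and pos: "\<And>z a. z \<in> Z \<Longrightarrow> a \<in> P z \<Longrightarrow> {z, a} \<in> E' \<and> \<sigma>' {z, a} = Positive"
    and neg: "\<And>z a. z \<in> Z \<Longrightarrow> a \<in> M z \<Longrightarrow> {z, a} \<in> E' \<and> \<sigma>' {z, a} = Negative"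
    using signed_degenerate_attach[where P = P and M = M, OF G Z(2) \<open>Z \<inter> V = {}\<close> PM] by metis
  have "\<exists>A B. A \<subseteq> V \<union> Z \<and> B \<subseteq> V \<union> Z \<and> A \<inter> B = {} \<and> card A = Suc j \<and> card B = Suc j \<and>
      (\<forall>a\<in>A. \<exists>b\<in>B. \<bar>f a - f b\<bar> < 1 - c) \<and>
      (\<forall>a\<in>A. \<forall>b\<in>A. a \<noteq> b \<longrightarrow> antipodally_separated r c (f a) (f b))"
    if "r \<le> s" and f: "circular_coloring r (V \<union> Z) E' \<sigma>' f" for r f
  proof -
    obtain A B where AB: "A \<subseteq> V" "B \<subseteq> V" "A \<inter> B = {}" "card A = j" "card B = j"
      and close: "\<forall>a\<in>A. \<exists>b\<in>B. \<bar>f a - f b\<bar> < 1 - c"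
      and sep: "\<forall>a\<in>A. \<forall>b\<in>A. a \<noteq> b \<longrightarrow> antipodally_separated r c (f a) (f b)"
      using forces[OF \<open>r \<le> s\<close> restrict[OF f]] by metis
    have circle: "f v \<in> circle r" if "v \<in> V \<union> Z" for v
      using f that by (simp add: circular_coloring_def)
    \<comment> \<open>The new vertices attached to the very pair that \<open>f\<close>
      realizes.\<close>
    define Y where "Y = {z \<in> Z. fst (p z) = (A, B)}"
    have "bij_betw p Y ({(A, B)} \<times> {..n})"
    proof (rule bij_betw_imageI)
      show "inj_on p Y" using p unfolding bij_betw_def Y_def by (auto intro: inj_on_subset)
      have "(A, B) \<in> Q" using AB by (simp add: Q_def)
      have "Y = Z \<inter> p -` ({(A, B)} \<times> UNIV)" by (auto simp: Y_def mem_Times_iff)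
      then have "p ` Y = p ` Z \<inter> {(A, B)} \<times> UNIV" by blast
      also have "p ` Z = Q \<times> {..n}" using p by (simp add: bij_betw_def)
      also have "Q \<times> {..n} \<inter> {(A, B)} \<times> UNIV = {(A, B)} \<times> {..n}"
        using \<open>(A, B) \<in> Q\<close> by auto
      finally show "p ` Y = {(A, B)} \<times> {..n}" .
    qed
    then have "card Y = n + 1" using bij_betw_same_card by fastforce
    moreover have "finite Y" using Z by (simp add: Y_def)
    moreover have "f y \<in> {0..<r}" if "y \<in> Y" for y
      using circle[of y] that by (auto simp: Y_def circle_def)
    \<comment> \<open>\<open>x\<close> will extend \<open>A\<close>, and \<open>y\<close> will be
      its close partner in \<open>B\<close>.\<close>
    ultimately obtain x y where xy: "x \<in> Y" "y \<in> Y" "x \<noteq> y" "\<bar>f x - f y\<bar> < 1 - c"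
      using close_pair[of Y f r "1 - c"] c n \<open>r \<le> s\<close> by fastforce
    then have x: "x \<in> Z" "P x = A" "M x = B" and y: "y \<in> Z"
      by (auto simp: Y_def P_def M_def)
    have new: "x \<notin> V" "y \<notin> V" using x y Z by auto
    have "antipodally_separated r c (f x) (f a)" if "a \<in> A" for a
    proof -
      obtain b where b: "b \<in> B" "\<bar>f a - f b\<bar> < 1 - c" using close \<open>a \<in> A\<close> by blast
      have "circ_dist r (f x) (f a) \<ge> 1" "circ_dist r (f x) (antipode r (f b)) \<ge> 1"
        using f pos[of x a] neg[of x b] x b \<open>a \<in> A\<close> unfolding circular_coloring_def by blast+
      then show ?thesis
        using antipodally_separatedI[of "f a" r "f b" "f x" c] circle b c AB x \<open>a \<in> A\<close> by blast
    qed
    then have "\<forall>a\<in>insert x A. \<forall>b\<in>insert x A. a \<noteq> b \<longrightarrow> antipodally_separated r c (f a) (f b)"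
      using sep antipodally_separated_commute by blast
    moreover have "card (insert x A) = Suc j" "card (insert y B) = Suc j"
      using AB new finV finite_subset by (metis card_insert_disjoint subsetD)+
    moreover have "insert x A \<inter> insert y B = {}" using AB new xy by blast
    moreover have "\<forall>a\<in>insert x A. \<exists>b\<in>insert y B. \<bar>f a - f b\<bar> < 1 - c" using close xy by blast
    moreover have "insert x A \<subseteq> V \<union> Z" "insert y B \<subseteq> V \<union> Z" using AB x y by auto
    ultimately show ?thesis
      by (intro exI[of _ "insert x A"] exI[of _ "insert y B"] conjI)
  qed
  note step = this
  show ?case
    by (rule exI[of _ "V \<union> Z"], rule exI[of _ E'], rule exI[of _ \<sigma>'], rule conjI[OF G'],
      intro allI impI, elim conjE, rule step)
qed

lemma signed_degenerate_not_colorable: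
  fixes s :: real
  assumes "d > 0" and s: "s < 2 * real (d div 2) + 2"
  shows "\<exists>V E \<sigma>. (V, E, \<sigma>) \<in> (signed_degenerate d ::
      ('a::infinite set \<times> 'a set set \<times> ('a set \<Rightarrow> sign)) set) \<and>
    (\<forall>r f. r \<le> s \<longrightarrow> \<not> circular_coloring r V E \<sigma> f)"
proof (cases "d div 2 = 0")
  case True
  obtain u v :: 'a where uv: "u \<noteq> v"
    by (metis (full_types) ex_new_if_finite finite.emptyI finite_insert infinite_UNIV insertI1)
  have "degree F w \<le> d" if "F \<subseteq> {{u, v}}" for F w
  proof -
    have "card {e \<in> F. w \<in> e} \<le> card {{u, v}}" using that by (intro card_mono) auto
    then show ?thesis using \<open>d > 0\<close> by (simp add: degree_def)
  qed
  then have "({u, v}, {{u, v}}, \<lambda>_. Positive) \<in> signed_degenerate d"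
    using uv by (auto simp: signed_degenerate_def simple_graph_def degenerate_def subgraph_def)
  moreover have "\<not> circular_coloring r {u, v} {{u, v}} (\<lambda>_. Positive) f" if "r \<le> s" for r f
  proof
    assume "circular_coloring r {u, v} {{u, v}} (\<lambda>_. Positive) f"
    then have "circ_dist r (f u) (f v) \<ge> 1" by (auto simp: circular_coloring_def)
    \<comment> \<open>A circular distance never exceeds \<open>r / 2\<close>, which here is less
      than \<open>1\<close>.\<close>
    then show False using that s True by (simp add: circ_dist_def)
  qed
  ultimately show ?thesis by blast
next
  case False
  let ?k = "real (d div 2)"
  \<comment> \<open>\<open>c\<close> must be positive even if \<open>s\<close> is not, and so close
    to \<open>1\<close> that \<open>d div 2 + 1\<close> points at mutual distance \<open>c\<close>
    do not fit on a circle of circumference \<open>s / 2\<close>.\<close>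
  have "max 0 (s / 2 / (?k + 1)) < 1" using s by (simp add: field_simps)
  then obtain c where c: "max 0 (s / 2 / (?k + 1)) < c" "c < 1" using dense by blast
  then have less: "s / 2 < (?k + 1) * c" by (simp add: field_simps)
  have "0 < c" using c by simp
  from signed_degenerate_forces_separation[OF this c(2) order_refl, of d s, where ?'a = 'a]
  obtain V :: "'a set" and E \<sigma> where G: "(V, E, \<sigma>) \<in> signed_degenerate d"
    and forces: "\<forall>r f. r \<le> s \<and> circular_coloring r V E \<sigma> f \<longrightarrow>
      (\<exists>A B. A \<subseteq> V \<and> B \<subseteq> V \<and> A \<inter> B = {} \<and> card A = d div 2 + 1 \<and> card B = d div 2 + 1 \<and>
        (\<forall>a\<in>A. \<exists>b\<in>B. \<bar>f a - f b\<bar> < 1 - c) \<and>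
        (\<forall>a\<in>A. \<forall>b\<in>A. a \<noteq> b \<longrightarrow> antipodally_separated r c (f a) (f b)))"
    by blast
  have "\<not> circular_coloring r V E \<sigma> f" if "r \<le> s" for r f
  proof
    assume f: "circular_coloring r V E \<sigma> f"
    with that forces obtain A where A: "A \<subseteq> V" "card A = d div 2 + 1"
      "\<forall>a\<in>A. \<forall>b\<in>A. a \<noteq> b \<longrightarrow> antipodally_separated r c (f a) (f b)"
      by meson
    have "real (card A) * c \<le> r / 2"
      by (rule antipodally_separated_card[where f = f])
        (use A f c False in \<open>auto simp: circular_coloring_def intro: card_ge_0_finite\<close>)
    then show False using A less that by (simp add: algebra_simps)
  qed
  then show ?thesis using G by blast
qed

theorem proposition6p1:
  fixes d :: nat
  assumes "d > 0"
  shows "(SUP (V, E, \<sigma>) \<in> (signed_degenerate d ::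
             ('a::infinite set \<times> 'a set set \<times> ('a set \<Rightarrow> sign)) set).
           circular_chromatic_number V E \<sigma>)
         = ereal (2 * of_int \<lfloor>real d / 2\<rfloor> + 2)"
proof -
  define n where "n = 2 * (d div 2) + 2"
  have floor: "2 * of_int \<lfloor>real d / 2\<rfloor> + 2 = real n"
    using floor_divide_of_nat_eq[of d 2, where ?'a = real] by (simp add: n_def)
  let ?S = "SUP (V, E, \<sigma>) \<in> (signed_degenerate d ::
             ('a set \<times> 'a set set \<times> ('a set \<Rightarrow> sign)) set). circular_chromatic_number V E \<sigma>"
  have "?S \<le> ereal (real n)"
  proof (rule SUP_least)
    fix G :: "'a set \<times> 'a set set \<times> ('a set \<Rightarrow> sign)"
    assume G: "G \<in> signed_degenerate d"
    obtain V E \<sigma> where VE: "G = (V, E, \<sigma>)" by (cases G) auto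
    have "\<exists>f. circular_coloring (real n) V E \<sigma> f"
      using G VE by (intro degenerate_circular_coloring) (auto simp: signed_degenerate_def n_def)
    then have "circular_chromatic_number V E \<sigma> \<le> ereal (real n)"
      unfolding circular_chromatic_number_def by (intro INF_lower) (auto simp: n_def)
    then show "(case G of (V, E, \<sigma>) \<Rightarrow> circular_chromatic_number V E \<sigma>) \<le> ereal (real n)"
      using VE by simp
  qed
  moreover have "ereal (real n) \<le> ?S"
  \<comment> \<open>The supremum need not be attained: each real \<open>y\<close> below
    \<open>n\<close> is bounded by the circular chromatic number of some graph depending on
    \<open>y\<close>.\<close>
  proof (rule dense_le)
    fix y assume y: "y < ereal (real n)"
    show "y \<le> ?S"
    proof (cases y)
      case (real s)
      then have "s < 2 * real (d div 2) + 2" using y by (simp add: n_def)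
      then obtain V :: "'a set" and E \<sigma> where G: "(V, E, \<sigma>) \<in> signed_degenerate d"
        and "\<And>r f. circular_coloring r V E \<sigma> f \<Longrightarrow> s < r"
        using signed_degenerate_not_colorable[OF \<open>d > 0\<close>] by (metis not_le)
      then have "y \<le> circular_chromatic_number V E \<sigma>"
        unfolding circular_chromatic_number_def real
        by (intro INF_greatest) (auto intro: less_imp_le)
      also have "\<dots> \<le> ?S" using SUP_upper[OF G, of "\<lambda>(V, E, \<sigma>). circular_chromatic_number V E \<sigma>"] by simp
      finally show ?thesis .
    qed (use y in auto)
  qed
  ultimately show ?thesis unfolding floor by (rule antisym)
qed

end
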